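(* Let $n$ and $N$ be positive even integers with $N\ge n$, and let $P\in\{P_n^{<,<},P_n^{>,>}\}$. Then \[ \mathrm{ex}_<(N,P)\le nN\left(\log_2(N/n)+2\right). \]
   Context: An ordered graph is a graph whose vertex set is equipped with a total order; an $N$-vertex ordered graph is identified with a graph on $[N]=\{1,\dots,N\}$ ordered as the integers. An ordered graph $G$ contains an ordered graph $H$ if there is an injection $f:V(H)\to V(G)$ such that $f(i)<f(j)$ whenever $i<j$, and $f(i)f(j)\in E(G)$ whenever $ij\in E(H)$; otherwise $G$ avoids $H$. The ordered Turán number $\mathrm{ex}_<(N,H)$ is the maximum number of edges of an ordered graph on $[N]$ avoiding $H$. For $n=2k$ even: $P_n^{<,<}$ is the ordered path on $[n]$ with vertex sequence $v_1,\dots,v_n$ along the path given by $v_{2j-1}=j$, $v_{2j}=k+j$ ($j=1,\dots,k$); and $P_n^{>,>}$ is the ordered path on $[n]$ with vertex sequence given by $v_{2j-1}=k+1-j$, $v_{2j}=2k+1-j$ ($j=1,\dots,k$). *)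

theory Defs
  imports Complex_Main
begin

text \<open>
  The pair \<open>(N, E)\<close> stands for the ordered graph on \<open>{1..N}\<close>, with the order of the integers
  and edge set \<open>E\<close>; edges are two-element sets of vertices.
\<close>

type_synonym ograph = "nat \<times> nat set set"

definition verts :: "ograph \<Rightarrow> nat set" where
  "verts G = {1..fst G}"

definition edges :: "ograph \<Rightarrow> nat set set" where
  "edges G = snd G"

definition ordered_graph :: "ograph \<Rightarrow> bool" where
  "ordered_graph G \<longleftrightarrow> (\<forall>e\<in>edges G. e \<subseteq> verts G \<and> card e = 2)"

definition contains :: "ograph \<Rightarrow> ograph \<Rightarrow> bool" where
  "contains G H \<longleftrightarrow>
     (\<exists>f. f ` verts H \<subseteq> verts G \<and> inj_on f (verts H) \<and>
          (\<forall>i\<in>verts H. \<forall>j\<in>verts H. i < j \<longrightarrow> f i < f j) \<and>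
          (\<forall>i\<in>verts H. \<forall>j\<in>verts H. {i, j} \<in> edges H \<longrightarrow> {f i, f j} \<in> edges G))"

abbreviation avoids :: "ograph \<Rightarrow> ograph \<Rightarrow> bool" where
  "avoids G H \<equiv> \<not> contains G H"

text \<open>
  If \<open>H\<close> has an edge, the set below is finite and contains \<open>0\<close> (from the edgeless graph),
  so the maximum is attained; see \<open>ex_ord_set\<close>.
\<close>

definition ex_ord :: "nat \<Rightarrow> ograph \<Rightarrow> nat" where
  "ex_ord N H =
     Max {card (edges G) | G. ordered_graph G \<and> verts G = {1..N} \<and> avoids G H}"

definition ordered_path :: "nat \<Rightarrow> (nat \<Rightarrow> nat) \<Rightarrow> ograph" where
  "ordered_path n v = (n, {{v i, v (i + 1)} | i. 1 \<le> i \<and> i < n})"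

text \<open>
  With \<open>n = 2 * k\<close>, the vertex sequences in terms of the position \<open>i\<close> along the path, where
  \<open>j = (i + 1) div 2\<close> for \<open>i = 2 * j - 1\<close> and \<open>j = i div 2\<close> for \<open>i = 2 * j\<close>.
\<close>

definition seq_lt_lt :: "nat \<Rightarrow> nat \<Rightarrow> nat" where
  "seq_lt_lt k i = (if odd i then (i + 1) div 2 else k + i div 2)"

definition seq_gt_gt :: "nat \<Rightarrow> nat \<Rightarrow> nat" where
  "seq_gt_gt k i = (if odd i then k + 1 - (i + 1) div 2 else 2 * k + 1 - i div 2)"

definition P_lt_lt :: "nat \<Rightarrow> ograph" where
  "P_lt_lt n = ordered_path n (seq_lt_lt (n div 2))"

definition P_gt_gt :: "nat \<Rightarrow> ograph" where
  "P_gt_gt n = ordered_path n (seq_gt_gt (n div 2))"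

lemma seq_lt_lt_odd: "j \<ge> 1 \<Longrightarrow> seq_lt_lt k (2 * j - 1) = j"
  by (simp add: seq_lt_lt_def)

lemma seq_lt_lt_even: "seq_lt_lt k (2 * j) = k + j"
  by (simp add: seq_lt_lt_def)

lemma seq_gt_gt_odd: "j \<ge> 1 \<Longrightarrow> seq_gt_gt k (2 * j - 1) = k + 1 - j"
  by (simp add: seq_gt_gt_def)

lemma seq_gt_gt_even: "seq_gt_gt k (2 * j) = 2 * k + 1 - j"
  by (simp add: seq_gt_gt_def)

lemma bij_betw_seq_lt_lt: "bij_betw (seq_lt_lt k) {1..2 * k} {1..2 * k}"
proof -
  have inj: "inj_on (seq_lt_lt k) {1..2 * k}"
  proof (rule inj_onI)
    fix x y assume "x \<in> {1..2 * k}" "y \<in> {1..2 * k}" "seq_lt_lt k x = seq_lt_lt k y"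
    then have "1 \<le> x" "x \<le> 2 * k" "1 \<le> y" "y \<le> 2 * k" "seq_lt_lt k x = seq_lt_lt k y"
      by simp_all
    then show "x = y"
      unfolding seq_lt_lt_def
      by (cases "even x"; cases "even y"; elim evenE oddE; simp)
  qed
  have "1 \<le> seq_lt_lt k x \<and> seq_lt_lt k x \<le> 2 * k" if "1 \<le> x" "x \<le> 2 * k" for x
    using that unfolding seq_lt_lt_def by (auto elim!: evenE oddE)
  then have "seq_lt_lt k ` {1..2 * k} \<subseteq> {1..2 * k}"
    by auto
  from endo_inj_surj[OF _ this inj] inj show ?thesis
    by (simp add: bij_betw_def)
qed

lemma bij_betw_seq_gt_gt: "bij_betw (seq_gt_gt k) {1..2 * k} {1..2 * k}"
proof -
  have inj: "inj_on (seq_gt_gt k) {1..2 * k}"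
  proof (rule inj_onI)
    fix x y assume "x \<in> {1..2 * k}" "y \<in> {1..2 * k}" "seq_gt_gt k x = seq_gt_gt k y"
    then have "1 \<le> x" "x \<le> 2 * k" "1 \<le> y" "y \<le> 2 * k" "seq_gt_gt k x = seq_gt_gt k y"
      by simp_all
    then show "x = y"
      unfolding seq_gt_gt_def
      by (cases "even x"; cases "even y"; elim evenE oddE; simp)
  qed
  have "1 \<le> seq_gt_gt k x \<and> seq_gt_gt k x \<le> 2 * k" if "1 \<le> x" "x \<le> 2 * k" for x
    using that unfolding seq_gt_gt_def by (auto elim!: evenE oddE)
  then have "seq_gt_gt k ` {1..2 * k} \<subseteq> {1..2 * k}"
    by auto
  from endo_inj_surj[OF _ this inj] inj show ?thesis
    by (simp add: bij_betw_def)
qed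

lemma ordered_graph_ordered_path:
  assumes "bij_betw v {1..n} {1..n}"
  shows "ordered_graph (ordered_path n v)"
  unfolding ordered_graph_def
proof
  fix e assume "e \<in> edges (ordered_path n v)"
  then obtain i where e: "e = {v i, v (i + 1)}" and i: "1 \<le> i" "i < n"
    by (auto simp: ordered_path_def edges_def)
  then have "i \<in> {1..n}" "i + 1 \<in> {1..n}" by auto
  then have "v i \<in> {1..n}" "v (i + 1) \<in> {1..n}" "v i \<noteq> v (i + 1)"
    using bij_betwE[OF assms] inj_onD[OF bij_betw_imp_inj_on[OF assms], of i "i + 1"]
    by (blast, blast, fastforce)
  with e show "e \<subseteq> verts (ordered_path n v) \<and> card e = 2"
    by (simp add: verts_def ordered_path_def)
qed

lemma ex_ord_set:
  fixes H :: ograph and N :: nat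
  defines "S \<equiv> {card (edges G) | G. ordered_graph G \<and> verts G = {1..N} \<and> avoids G H}"
  assumes "ordered_graph H" "edges H \<noteq> {}"
  shows "finite S" "0 \<in> S"
proof -
  have "S \<subseteq> card ` Pow (Pow {1..N})"
  proof
    fix c assume "c \<in> S"
    then obtain G where G: "c = card (edges G)" "ordered_graph G" "verts G = {1..N}"
      unfolding S_def by blast
    then have "edges G \<in> Pow (Pow {1..N})"
      unfolding ordered_graph_def by auto
    with G(1) show "c \<in> card ` Pow (Pow {1..N})"
      by (rule image_eqI)
  qed
  then show "finite S" by (rule finite_subset) simp
  obtain e where e: "e \<in> edges H" using assms by blast
  then have "e \<subseteq> verts H" "card e = 2"
    using assms(2) by (auto simp: ordered_graph_def)
  then obtain x y where "e = {x, y}" "x \<in> verts H" "y \<in> verts H"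
    by (auto simp: card_2_iff)
  with e have "avoids (N, {}) H"
    by (auto simp: contains_def edges_def)
  moreover have "ordered_graph (N, {})" "verts (N, {}) = {1..N}" "card (edges (N, {})) = 0"
    by (auto simp: ordered_graph_def edges_def verts_def)
  ultimately show "0 \<in> S" unfolding S_def by (intro CollectI exI[of _ "(N, {})"]) simp
qed

end

theory Submission
  imports Defs
begin

text \<open>
  Read the edges between two sets of vertices, one entirely below the other, as the ones of a
  0/1-matrix. Both paths are then staircases in this matrix, alternately moving right and down,
  the second one being the transpose of the first. Discarding the topmost one of each column and
  then the leftmost one of each remaining row costs at most one entry per vertex, and every
  staircase found in the rest can be prolonged by two steps at its start. Hence the number of
  edges across a cut is at most linear in the number of vertices, and halving \<open>{1..N}\<close>
  repeatedly, down to intervals of length at most \<open>n\<close>, yields the logarithmic factor.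
\<close>

section \<open>Staircases in a 0/1-matrix\<close>

text \<open>With \<open>x\<close> as the row and \<open>y\<close> as the column index, these are the
  leftmost ones of the rows. The row determines such an entry, so \<open>fst\<close> is injective on
  them. The next lemma treats the topmost ones of the columns in the same way.\<close>

lemma card_fst_minimal_le:
  fixes E :: "('a \<times> 'b::linorder) set"
  assumes "finite A" and "E \<subseteq> A \<times> B"
  shows "card {(x, y) \<in> E. \<nexists>y'. y' < y \<and> (x, y') \<in> E} \<le> card A"
proof (rule card_inj_on_le[where f = fst])
  show "inj_on fst {(x, y) \<in> E. \<nexists>y'. y' < y \<and> (x, y') \<in> E}"
    by (force simp: inj_on_def intro: antisym leI)
qed (use assms in auto)

lemma card_snd_minimal_le:
  fixes E :: "('a::linorder \<times> 'b) set"
  assumes "finite B" and "E \<subseteq> A \<times> B"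
  shows "card {(x, y) \<in> E. \<nexists>x'. x' < x \<and> (x', y) \<in> E} \<le> card B"
proof (rule card_inj_on_le[where f = snd])
  show "inj_on snd {(x, y) \<in> E. \<nexists>x'. x' < x \<and> (x', y) \<in> E}"
    by (force simp: inj_on_def intro: antisym leI)
qed (use assms in auto)

text \<open>The staircase visits \<open>l + 1\<close> rows and \<open>l + 1\<close> columns in
  \<open>2 * l + 1\<close> entries, starting with a move down. Each unit of \<open>l\<close> is paid
  for by one round of deletions, \<open>T\<close> by the columns and \<open>U\<close> by the
  rows.\<close>

lemma staircase_exists:
  fixes E :: "('a::linorder \<times> 'b::linorder) set"
  assumes "finite A" and "finite B" and "E \<subseteq> A \<times> B"
    and "l * (card A + card B) < card E"
  shows "\<exists>a b. (\<forall>i\<le>l. (a i, b i) \<in> E) \<and> (\<forall>i<l. (a (Suc i), b i) \<in> E) \<and>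
    (\<forall>i<l. a i < a (Suc i) \<and> b i < b (Suc i))"
  using assms(3,4)
proof (induction l arbitrary: E)
  case 0
  then obtain x y where "(x, y) \<in> E"
    by (metis card.empty card_gt_0_iff ex_in_conv less_nat_zero_code mult_0 surj_pair)
  then show ?case
    by (intro exI[of _ "\<lambda>_. x"] exI[of _ "\<lambda>_. y"]) simp
next
  case (Suc l)
  define T where "T = {(x, y) \<in> E. \<nexists>x'. x' < x \<and> (x', y) \<in> E}"
  define F where "F = E - T"
  define U where "U = {(x, y) \<in> F. \<nexists>y'. y' < y \<and> (x, y') \<in> F}"
  have E: "finite E" "E \<subseteq> A \<times> B" and F: "F \<subseteq> A \<times> B"
    using Suc.prems(1) assms(1,2) by (auto simp: F_def intro: finite_subset)
  have "card T \<le> card B" "card U \<le> card A"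
    using card_snd_minimal_le[OF assms(2) E(2)] card_fst_minimal_le[OF assms(1) F]
    by (simp_all add: T_def U_def)
  moreover have "card F = card E - card T" "card (F - U) = card F - card U"
    unfolding F_def using E(1)
    by (auto intro!: card_Diff_subset intro: finite_subset simp: T_def U_def F_def)
  ultimately have "l * (card A + card B) < card (F - U)"
    using Suc.prems(2) by simp
  with F Suc.IH[of "F - U"] obtain a b where
    ab: "\<And>i. i \<le> l \<Longrightarrow> (a i, b i) \<in> F - U" "\<And>i. i < l \<Longrightarrow> (a (Suc i), b i) \<in> F - U"
      "\<And>i. i < l \<Longrightarrow> a i < a (Suc i) \<and> b i < b (Suc i)"
    by blast
  \<comment> \<open>The deletions are undone in reverse order. The start lies outside
    \<open>U\<close>, so \<open>F\<close> has an entry to its left; that entry lies outside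
    \<open>T\<close>, so \<open>E\<close> has an entry above it.\<close>
  from ab(1)[of 0] obtain y where y: "y < b 0" "(a 0, y) \<in> F"
    by (auto simp: U_def)
  then obtain x where x: "x < a 0" "(x, y) \<in> E"
    by (auto simp: F_def T_def)
  have "F \<subseteq> E" by (auto simp: F_def)
  with ab x y show ?case
    by (intro exI[of _ "case_nat x a"] exI[of _ "case_nat y b"])
      (auto split: nat.split)
qed

section \<open>Embedding the two ordered paths\<close>

lemma strict_mono_on_atMost_Suc:
  fixes f :: "nat \<Rightarrow> 'a::order"
  assumes "\<And>i. i < l \<Longrightarrow> f i < f (Suc i)" and "i < j" and "j \<le> l"
  shows "f i < f j"
  using assms(2,3)
  by (induction j) (metis Suc_leD Suc_le_lessD assms(1) less_Suc_eq less_trans less_nat_zero_code)+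

lemma contains_ordered_pathI:
  assumes "f ` {1..n} \<subseteq> verts G"
    and mono: "\<And>i j. 1 \<le> i \<Longrightarrow> i < j \<Longrightarrow> j \<le> n \<Longrightarrow> f i < f j"
    and edge: "\<And>i. 1 \<le> i \<Longrightarrow> i < n \<Longrightarrow> {f (v i), f (v (i + 1))} \<in> edges G"
  shows "contains G (ordered_path n v)"
proof -
  have "inj_on f {1..n}"
    by (rule linorder_inj_onI) (use mono in \<open>fastforce+\<close>)
  \<comment> \<open>An equation between unordered pairs does not tell which end is which; taking
    images under \<open>f\<close> avoids the case distinction.\<close>
  moreover have "{f i, f j} \<in> edges G" if "{i, j} = {v m, v (m + 1)}" "1 \<le> m" "m < n" for i j m
  proof -
    have "f ` {i, j} = f ` {v m, v (m + 1)}"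
      by (simp only: that(1))
    with edge[OF that(2,3)] show ?thesis by simp
  qed
  ultimately show ?thesis
    unfolding contains_def using assms(1) mono
    by (intro exI[of _ f]) (auto simp: verts_def ordered_path_def edges_def)
qed

text \<open>The lower half \<open>{1..k}\<close> is sent along \<open>a\<close> and the upper half
  along \<open>b\<close>, both shifted to start at index 0. Monotonicity does not involve the order
  along the path, so \<open>v\<close> stays arbitrary and both paths can share this
  argument.\<close>

lemma contains_ordered_path_interleaveI:
  fixes a b :: "nat \<Rightarrow> nat"
  assumes "\<And>i. i < k \<Longrightarrow> a i \<in> verts G" and "\<And>i. i < k \<Longrightarrow> b i \<in> verts G"
    and a: "\<And>i. Suc i < k \<Longrightarrow> a i < a (Suc i)"
    and b: "\<And>i. Suc i < k \<Longrightarrow> b i < b (Suc i)"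
    and "\<And>i j. i < k \<Longrightarrow> j < k \<Longrightarrow> a i < b j"
    and edge: "\<And>i. 1 \<le> i \<Longrightarrow> i < 2 * k \<Longrightarrow>
      {(if v i \<le> k then a (v i - 1) else b (v i - k - 1)),
       (if v (i + 1) \<le> k then a (v (i + 1) - 1) else b (v (i + 1) - k - 1))} \<in> edges G"
  shows "contains G (ordered_path (2 * k) v)"
proof (rule contains_ordered_pathI[where f = "\<lambda>i. if i \<le> k then a (i - 1) else b (i - k - 1)"])
  show "(\<lambda>i. if i \<le> k then a (i - 1) else b (i - k - 1)) ` {1..2 * k} \<subseteq> verts G"
    using assms(1,2) by auto
next
  fix i j :: nat
  assume ij: "1 \<le> i" "i < j" "j \<le> 2 * k"
  have "a (i - 1) < a (j - 1)" if "j \<le> k"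
    by (rule strict_mono_on_atMost_Suc[of "k - 1"]) (use that ij a in auto)
  moreover have "b (i - k - 1) < b (j - k - 1)" if "k < i"
    by (rule strict_mono_on_atMost_Suc[of "k - 1"]) (use that ij b in auto)
  ultimately show "(if i \<le> k then a (i - 1) else b (i - k - 1))
      < (if j \<le> k then a (j - 1) else b (j - k - 1))"
    using ij assms(5) by auto
qed (use edge in auto)

text \<open>The path becomes \<open>a 0\<close>, \<open>b 0\<close>, \<open>a 1\<close>,
  \<open>b 1\<close> and so on: odd positions are followed by a \<open>diag\<close> edge, even ones
  by an \<open>off\<close> edge.\<close>

lemma contains_P_lt_ltI:
  assumes "\<And>i. i < k \<Longrightarrow> a i \<in> verts G" and "\<And>i. i < k \<Longrightarrow> b i \<in> verts G"
    and "\<And>i. Suc i < k \<Longrightarrow> a i < a (Suc i)" and "\<And>i. Suc i < k \<Longrightarrow> b i < b (Suc i)"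
    and "\<And>i j. i < k \<Longrightarrow> j < k \<Longrightarrow> a i < b j"
    and diag: "\<And>i. i < k \<Longrightarrow> {a i, b i} \<in> edges G"
    and off: "\<And>i. Suc i < k \<Longrightarrow> {a (Suc i), b i} \<in> edges G"
  shows "contains G (P_lt_lt (2 * k))"
  unfolding P_lt_lt_def
proof (simp, rule contains_ordered_path_interleaveI[of k a G b])
  fix i :: nat assume i: "1 \<le> i" "i < 2 * k"
  show "{(if seq_lt_lt k i \<le> k then a (seq_lt_lt k i - 1) else b (seq_lt_lt k i - k - 1)),
     (if seq_lt_lt k (i + 1) \<le> k then a (seq_lt_lt k (i + 1) - 1)
      else b (seq_lt_lt k (i + 1) - k - 1))} \<in> edges G"
  proof (cases "even i")
    case True
    then obtain j where "i = 2 * Suc j"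
      using i by (metis evenE not0_implies_Suc mult_0_right not_one_le_zero)
    then show ?thesis
      using off[of j] i by (simp add: seq_lt_lt_def insert_commute)
  next
    case False
    then obtain j where "i = 2 * j + 1" by (rule oddE)
    then show ?thesis
      using diag[of j] i by (simp add: seq_lt_lt_def)
  qed
qed (use assms in auto)

text \<open>The path now runs downwards through \<open>a (k - 1)\<close>, \<open>b (k - 1)\<close>,
  \<open>a (k - 2)\<close> and so on to \<open>a 0\<close>, \<open>b 0\<close>. Hence an
  \<open>off\<close> edge joins an upper vertex to the lower vertex of the preceding index.\<close>

lemma contains_P_gt_gtI:
  assumes "\<And>i. i < k \<Longrightarrow> a i \<in> verts G" and "\<And>i. i < k \<Longrightarrow> b i \<in> verts G"
    and "\<And>i. Suc i < k \<Longrightarrow> a i < a (Suc i)" and "\<And>i. Suc i < k \<Longrightarrow> b i < b (Suc i)"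
    and "\<And>i j. i < k \<Longrightarrow> j < k \<Longrightarrow> a i < b j"
    and diag: "\<And>i. i < k \<Longrightarrow> {a i, b i} \<in> edges G"
    and off: "\<And>i. Suc i < k \<Longrightarrow> {a i, b (Suc i)} \<in> edges G"
  shows "contains G (P_gt_gt (2 * k))"
  unfolding P_gt_gt_def
proof (simp, rule contains_ordered_path_interleaveI[of k a G b])
  fix i :: nat assume i: "1 \<le> i" "i < 2 * k"
  show "{(if seq_gt_gt k i \<le> k then a (seq_gt_gt k i - 1) else b (seq_gt_gt k i - k - 1)),
     (if seq_gt_gt k (i + 1) \<le> k then a (seq_gt_gt k (i + 1) - 1)
      else b (seq_gt_gt k (i + 1) - k - 1))} \<in> edges G"
  proof (cases "even i")
    case True
    then obtain j where j: "i = 2 * Suc j"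
      using i by (metis evenE not0_implies_Suc mult_0_right not_one_le_zero)
    \<comment> \<open>Positions count up while indices count down. Since \<open>i < 2 * k\<close>,
      the subtraction is exact, and writing \<open>k\<close> as a sum removes the truncated
      differences from \<open>seq_gt_gt\<close>.\<close>
    define m where "m = k - j - 2"
    have "k = m + j + 2" using i j by (simp add: m_def)
    then show ?thesis
      using off[of m] i j by (simp add: seq_gt_gt_def insert_commute)
  next
    case False
    then obtain j where j: "i = 2 * j + 1" by (rule oddE)
    define m where "m = k - j - 1"
    have "k = m + j + 1" using i j by (simp add: m_def)
    then show ?thesis
      using diag[of m] i j by (simp add: seq_gt_gt_def)
  qed
qed (use assms in auto)

section \<open>Edges across a cut\<close>

lemma card_cut_le:
  assumes "k > 0" and P: "P \<in> {P_lt_lt (2 * k), P_gt_gt (2 * k)}" and "avoids G P"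
    and AB: "A \<subseteq> verts G" "B \<subseteq> verts G" "\<And>x y. x \<in> A \<Longrightarrow> y \<in> B \<Longrightarrow> x < y"
  shows "card {(x, y) \<in> A \<times> B. {x, y} \<in> edges G} \<le> 2 * k * (card A + card B)"
proof (rule ccontr)
  define E where "E = {(x, y) \<in> A \<times> B. {x, y} \<in> edges G}"
  have E: "E \<subseteq> A \<times> B" "E\<inverse> \<subseteq> B \<times> A"
    by (auto simp: E_def)
  have fin: "finite A" "finite B"
    using AB by (auto intro: finite_subset simp: verts_def)
  assume "\<not> ?thesis"
  then have "2 * k * (card A + card B) < card E" by (simp add: E_def)
  \<comment> \<open>Finding \<open>k\<close> vertices on each side takes a staircase with
    \<open>l = k - 1\<close>. The bound is stated with the larger factor \<open>2 * k\<close>, the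
    constant that the bisection uses throughout.\<close>
  moreover have "(k - 1) * (card A + card B) \<le> 2 * k * (card A + card B)"
    by (rule mult_right_mono) auto
  ultimately have less: "(k - 1) * (card A + card B) < card E" by linarith
  have "contains G P"
    using P
  proof (elim insertE emptyE)
    assume P: "P = P_lt_lt (2 * k)"
    obtain a b where ab: "\<And>i. i \<le> k - 1 \<Longrightarrow> (a i, b i) \<in> E"
      "\<And>i. i < k - 1 \<Longrightarrow> (a (Suc i), b i) \<in> E"
      "\<And>i. i < k - 1 \<Longrightarrow> a i < a (Suc i) \<and> b i < b (Suc i)"
      using staircase_exists[OF fin E(1) less] by blast
    have mem: "a i \<in> A" "b i \<in> B" "{a i, b i} \<in> edges G" if "i < k" for i
      using ab(1)[of i] that by (auto simp: E_def)
    have off: "{a (Suc i), b i} \<in> edges G" if "Suc i < k" for i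
      using ab(2)[of i] that by (auto simp: E_def)
    show ?thesis
      unfolding P using AB mem off ab(3) by (intro contains_P_lt_ltI[of k a G b]) auto
  next
    assume P: "P = P_gt_gt (2 * k)"
    \<comment> \<open>In the transposed matrix \<open>a\<close> runs through the upper side
      \<open>B\<close> and \<open>b\<close> through the lower side \<open>A\<close>. An entry
      \<open>(a (Suc i), b i)\<close> is then exactly an \<open>off\<close> edge of the second
      path.\<close>
    have "(k - 1) * (card B + card A) < card (E\<inverse>)"
      using less by (simp add: add.commute)
    then obtain a b where ab: "\<And>i. i \<le> k - 1 \<Longrightarrow> (a i, b i) \<in> E\<inverse>"
      "\<And>i. i < k - 1 \<Longrightarrow> (a (Suc i), b i) \<in> E\<inverse>"
      "\<And>i. i < k - 1 \<Longrightarrow> a i < a (Suc i) \<and> b i < b (Suc i)"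
      using staircase_exists[OF fin(2,1) E(2)] by blast
    have mem: "b i \<in> A" "a i \<in> B" "{b i, a i} \<in> edges G" if "i < k" for i
      using ab(1)[of i] that by (auto simp: E_def)
    have off: "{b i, a (Suc i)} \<in> edges G" if "Suc i < k" for i
      using ab(2)[of i] that by (auto simp: E_def)
    show ?thesis
      unfolding P using AB mem off ab(3) by (intro contains_P_gt_gtI[of k b G a]) auto
  qed
  with \<open>avoids G P\<close> show False by simp
qed

section \<open>Repeated halving\<close>

text \<open>The intervals of one level of the recursion are disjoint, so all cuts of a level
  together cost at most \<open>n * m\<close>. There are \<open>t\<close> such levels; the last
  summand \<open>n * m\<close> pays for the bottom intervals, whose length is at most
  \<open>n\<close>.\<close>

lemma card_le_by_bisection:
  fixes D :: "(nat \<times> nat) set"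
  assumes "\<And>x y. (x, y) \<in> D \<Longrightarrow> x < y"
    and cut: "\<And>p q r. card (D \<inter> {p..<q} \<times> {q..<r}) \<le> n * (r - p)"
    and "m \<le> n * 2 ^ t"
  shows "card (D \<inter> {p..<p + m} \<times> {p..<p + m}) \<le> n * m * (t + 1)"
  using assms(3)
proof (induction t arbitrary: p m)
  case 0
  have "card (D \<inter> {p..<p + m} \<times> {p..<p + m}) \<le> card ({p..<p + m} \<times> {p..<p + m})"
    by (rule card_mono) auto
  also have "\<dots> \<le> n * m" using 0 by (simp add: card_cartesian_product)
  finally show ?case by simp
next
  case (Suc t)
  define h where "h = m div 2"
  \<comment> \<open>For odd \<open>m\<close> the right part is longer by one; it still fits because
    \<open>m\<close> is at most the even number \<open>2 * (n * 2 ^ t)\<close>.\<close>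
  define h' where "h' = m - h"
  define q where "q = p + h"
  have m: "m = h + h'" "h \<le> n * 2 ^ t" "h' \<le> n * 2 ^ t" and r: "q + h' = p + m"
    using Suc.prems by (auto simp: h_def h'_def q_def)
  let ?L = "D \<inter> {p..<q} \<times> {p..<q}" and ?R = "D \<inter> {q..<q + h'} \<times> {q..<q + h'}"
    and ?C = "D \<inter> {p..<q} \<times> {q..<p + m}"
  \<comment> \<open>The fourth quadrant, from right to left, is empty since pairs in
    \<open>D\<close> are increasing.\<close>
  have "D \<inter> {p..<p + m} \<times> {p..<p + m} \<subseteq> ?L \<union> ?R \<union> ?C"
    using r assms(1) by fastforce
  then have "card (D \<inter> {p..<p + m} \<times> {p..<p + m}) \<le> card (?L \<union> ?R \<union> ?C)"
    by (intro card_mono) auto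
  also have "\<dots> \<le> card ?L + card ?R + card ?C"
    by (meson add_le_mono1 card_Un_le order_trans)
  also have "\<dots> \<le> n * h * (t + 1) + n * h' * (t + 1) + n * m"
    using Suc.IH[OF m(2), of p] Suc.IH[OF m(3), of q] cut[of p q "p + m"]
    unfolding q_def by (intro add_mono) auto
  also have "\<dots> = n * m * (Suc t + 1)"
    by (simp add: m(1) algebra_simps)
  finally show ?case .
qed

section \<open>The edge bound for graphs avoiding a path\<close>

lemma card_edges_le:
  assumes "k > 0" and "P \<in> {P_lt_lt (2 * k), P_gt_gt (2 * k)}" and "avoids G P"
    and G: "ordered_graph G" "verts G = {1..N}" and "N \<le> 2 * k * 2 ^ t"
  shows "card (edges G) \<le> 2 * k * N * (t + 1)"
proof -
  \<comment> \<open>Listing every edge with its smaller end first turns the graph into a matrix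
    whose rectangles are cuts.\<close>
  define D where "D = {(x, y). x < y \<and> {x, y} \<in> edges G}"
  have D: "D \<subseteq> {1..N} \<times> {1..N}"
    using G by (auto simp: D_def ordered_graph_def)
  have "edges G = (\<lambda>(x, y). {x, y}) ` D"
  proof (intro equalityI subsetI)
    fix e assume e: "e \<in> edges G"
    then obtain x y where "e = {x, y}" "x \<noteq> y"
      using G by (auto simp: ordered_graph_def card_2_iff)
    with e show "e \<in> (\<lambda>(x, y). {x, y}) ` D"
      by (cases x y rule: linorder_cases) (force simp: D_def insert_commute)+
  qed (auto simp: D_def)
  then have "card (edges G) \<le> card D"
    using D by (simp add: card_image_le finite_subset)
  also have "D = D \<inter> {1..<1 + N} \<times> {1..<1 + N}"
    using D by auto
  also have "card \<dots> \<le> 2 * k * N * (t + 1)"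
  proof (rule card_le_by_bisection)
    fix p q r :: nat
    \<comment> \<open>The bisection asks for all \<open>p\<close>, \<open>q\<close>,
      \<open>r\<close>, so the intervals are first clipped to the vertex set.\<close>
    let ?A = "{p..<q} \<inter> {1..N}" and ?B = "{q..<r} \<inter> {1..N}"
    have "D \<inter> {p..<q} \<times> {q..<r} = {(x, y) \<in> ?A \<times> ?B. {x, y} \<in> edges G}"
      using D by (auto simp: D_def)
    also have "card \<dots> \<le> 2 * k * (card ?A + card ?B)"
      using G(2) by (intro card_cut_le[OF assms(1-3)]) auto
    also have "card ?A + card ?B = card (?A \<union> ?B)"
      by (rule card_Un_disjoint[symmetric]) auto
    \<comment> \<open>If \<open>p\<close>, \<open>q\<close>, \<open>r\<close> are not in order, one
      of the intervals is empty and so is the rectangle.\<close>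
    also have "card (?A \<union> ?B) \<le> card {p..<r}" if "p \<le> q" "q \<le> r"
      using that by (intro card_mono) auto
    finally show "card (D \<inter> {p..<q} \<times> {q..<r}) \<le> 2 * k * (r - p)"
      by (cases "p \<le> q \<and> q \<le> r") auto
  qed (use assms in \<open>auto simp: D_def\<close>)
  finally show ?thesis .
qed

theorem theorem1p6:
  fixes n N :: nat and P :: ograph
  assumes "n > 0" and "even n" and "N > 0" and "even N" and "N \<ge> n"
    and "P \<in> {P_lt_lt n, P_gt_gt n}"
  shows "real (ex_ord N P) \<le> real n * real N * (log 2 (real N / real n) + 2)"
proof -
  obtain k where k: "n = 2 * k" "k > 0"
    using assms(1,2) by (auto elim: evenE)
  have P: "P \<in> {P_lt_lt (2 * k), P_gt_gt (2 * k)}"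
    using assms(6) k by simp
  \<comment> \<open>An edge, here the first of the path, ensures that the maximum in
    \<open>ex_ord\<close> is attained by some graph.\<close>
  have "ordered_graph P" "edges P \<noteq> {}"
    using P k(2) ordered_graph_ordered_path[OF bij_betw_seq_lt_lt]
      ordered_graph_ordered_path[OF bij_betw_seq_gt_gt]
    by (auto simp: P_lt_lt_def P_gt_gt_def) (auto simp: ordered_path_def edges_def intro!: exI[of _ 1])
  note S = ex_ord_set[OF this, of N]
  have "ex_ord N P \<in> {card (edges G) | G. ordered_graph G \<and> verts G = {1..N} \<and> avoids G P}"
    unfolding ex_ord_def by (rule Max_in) (use S in auto)
  then obtain G where G: "ex_ord N P = card (edges G)" "ordered_graph G" "verts G = {1..N}"
    "avoids G P" by blast
  \<comment> \<open>This is the number of halvings that reach length at most \<open>n\<close>. As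
    \<open>N \<ge> n\<close>, the logarithm is nonnegative and \<open>nat\<close> changes nothing;
    rounding up adds at most 1, and the bottom level adds the other 1 of the constant 2.\<close>
  define t where "t = nat \<lceil>log 2 (real N / real n)\<rceil>"
  have "0 \<le> log 2 (real N / real n)"
    using assms by simp
  then have t: "log 2 (real N / real n) \<le> real t" "real t \<le> log 2 (real N / real n) + 1"
    unfolding t_def by linarith+
  have "real N / real n \<le> 2 powr real t"
    using t(1) assms by (simp add: log_le_iff)
  then have "real N \<le> real (n * 2 ^ t)"
    using assms by (simp add: powr_realpow field_simps)
  then have "N \<le> 2 * k * 2 ^ t"
    unfolding k(1) of_nat_le_iff .
  from card_edges_le[OF k(2) P G(4,2,3) this] have "ex_ord N P \<le> n * N * (t + 1)"
    by (simp add: G(1) k(1))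
  then have "real (ex_ord N P) \<le> real (n * N * (t + 1))"
    by (simp only: of_nat_le_iff)
  also have "\<dots> = real n * real N * (real t + 1)"
    by (simp add: algebra_simps)
  also have "\<dots> \<le> real n * real N * (log 2 (real N / real n) + 2)"
    using t(2) by (intro mult_left_mono) auto
  finally show ?thesis .
qed

end
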